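(* Let $(X_3,T)$ be a minimal topological dynamical system with $T$ a homeomorphism, and let $X_1\xleftarrow{\pi_1}X_2\xleftarrow{\pi_2}X_3$ be factor maps where $\pi_1$ is a non-trivial proximal extension, $\pi_2$ is a non-trivial distal extension and $X_1$ is distal. If the proximal relation $P(X_3)$ is not closed, then $(X_3,T)$ is strongly $\mathcal{F}_t$-sensitive.
   Context: A topological dynamical system: compact metric space with continuous surjection; minimal means every orbit is dense. A pair $(x,y)$ is proximal if $\inf_n d(T^nx,T^ny)=0$, otherwise distal; $P(X)$ denotes the set of proximal pairs; a system is distal if all pairs of distinct points are distal. For a factor map $\phi:X\to Y$ let $R_\phi=\{(x,y):\phi(x)=\phi(y)\}$; $\phi$ is a proximal extension if $R_\phi\subset P(X)$ and a distal extension if $R_\phi\cap P(X)=\Delta_X$. Non-trivial means not a conjugacy. $(X,T)$ is strongly $\mathcal{F}_t$-sensitive if there is $\delta>0$ such that for each nonempty open $U$ there are $x,y\in U$ with $\{n\in\mathbb{Z}_+:d(T^nx,T^ny)>\delta\}$ thick (containing arbitrarily long blocks of consecutive integers). *)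

theory Defs
  imports "HOL-Analysis.Analysis"
begin

definition tds :: "'a::metric_space set \<Rightarrow> ('a \<Rightarrow> 'a) \<Rightarrow> bool" where
  "tds X T \<longleftrightarrow> X \<noteq> {} \<and> compact X \<and> continuous_on X T \<and> T ` X = X"

definition orbit :: "('a \<Rightarrow> 'a) \<Rightarrow> 'a \<Rightarrow> 'a set" where
  "orbit T x = {(T ^^ n) x | n. True}"

definition minimal_tds :: "'a::metric_space set \<Rightarrow> ('a \<Rightarrow> 'a) \<Rightarrow> bool" where
  "minimal_tds X T \<longleftrightarrow> tds X T \<and> (\<forall>x\<in>X. X \<subseteq> closure (orbit T x))"

definition proximal :: "'a::metric_space set \<Rightarrow> ('a \<Rightarrow> 'a) \<Rightarrow> 'a \<Rightarrow> 'a \<Rightarrow> bool" where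
  "proximal X T x y \<longleftrightarrow> x \<in> X \<and> y \<in> X \<and>
     (INF n. dist ((T ^^ n) x) ((T ^^ n) y)) = 0"

definition proximal_rel :: "'a::metric_space set \<Rightarrow> ('a \<Rightarrow> 'a) \<Rightarrow> ('a \<times> 'a) set" where
  "proximal_rel X T = {(x, y). proximal X T x y}"

definition distal_tds :: "'a::metric_space set \<Rightarrow> ('a \<Rightarrow> 'a) \<Rightarrow> bool" where
  "distal_tds X T \<longleftrightarrow> (\<forall>x\<in>X. \<forall>y\<in>X. x \<noteq> y \<longrightarrow> \<not> proximal X T x y)"

definition factor_map :: "'a::metric_space set \<Rightarrow> ('a \<Rightarrow> 'a) \<Rightarrow> 'b::metric_space set \<Rightarrow> ('b \<Rightarrow> 'b)
    \<Rightarrow> ('a \<Rightarrow> 'b) \<Rightarrow> bool" where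
  "factor_map X T Y S \<phi> \<longleftrightarrow> tds X T \<and> tds Y S \<and> continuous_on X \<phi> \<and> \<phi> ` X = Y \<and>
     (\<forall>x\<in>X. \<phi> (T x) = S (\<phi> x))"

definition fiber_rel :: "'a set \<Rightarrow> ('a \<Rightarrow> 'b) \<Rightarrow> ('a \<times> 'a) set" where
  "fiber_rel X \<phi> = {(x, y). x \<in> X \<and> y \<in> X \<and> \<phi> x = \<phi> y}"

definition proximal_extension where
  "proximal_extension X T Y S \<phi> \<longleftrightarrow> factor_map X T Y S \<phi> \<and> fiber_rel X \<phi> \<subseteq> proximal_rel X T"

definition distal_extension where
  "distal_extension X T Y S \<phi> \<longleftrightarrow> factor_map X T Y S \<phi> \<and>
     fiber_rel X \<phi> \<inter> proximal_rel X T = Id_on X"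

definition conjugacy where
  "conjugacy X T Y S \<phi> \<longleftrightarrow> factor_map X T Y S \<phi> \<and> (\<exists>\<psi>. homeomorphism X Y \<phi> \<psi>)"

definition thick :: "nat set \<Rightarrow> bool" where
  "thick A \<longleftrightarrow> (\<forall>k. \<exists>m. {m..<m+k} \<subseteq> A)"

definition strongly_Ft_sensitive :: "'a::metric_space set \<Rightarrow> ('a \<Rightarrow> 'a) \<Rightarrow> bool" where
  "strongly_Ft_sensitive X T \<longleftrightarrow> (\<exists>\<delta>>0. \<forall>U. openin (top_of_set X) U \<and> U \<noteq> {} \<longrightarrow>
     (\<exists>x\<in>U. \<exists>y\<in>U. thick {n. dist ((T ^^ n) x) ((T ^^ n) y) > \<delta>}))"

end

theory Submission
  imports Defs
begin

text \<open>
  Let \<open>P\<close> be the proximal relation of \<open>(X, T)\<close>.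
  A pair \<open>(x\<^sub>0, y\<^sub>0)\<close> in the closure of \<open>P\<close> but not in \<open>P\<close> stays at
  distance at least some \<open>d > 0\<close> forever, so the compact set \<open>M\<close> of pairs in the closure of \<open>P\<close> with
  this property is nonempty and forward invariant, and by minimality it projects onto \<open>X\<close>.
  Given an open set \<open>U\<close>, minimality covers \<open>M\<close> by the sets of pairs whose second coordinate enters \<open>U\<close>
  at time \<open>j\<close>; by Baire the first projection of one of them has nonempty interior \<open>V\<close>. Take \<open>(a, b)\<close>
  in it with \<open>a \<in> V\<close> and a proximal pair \<open>(x, y)\<close> near \<open>(a, b)\<close>. Then \<open>x \<in> V\<close> has a partner \<open>x'\<close> with
  \<open>(x, x') \<in> M\<close>, and both \<open>T\<^sup>j x'\<close> and \<open>T\<^sup>j y\<close> lie in \<open>U\<close>. On the thick set of times when \<open>x\<close> and \<open>y\<close>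
  are close, \<open>x'\<close> and \<open>y\<close> are more than \<open>d/2\<close> apart.
\<close>

section \<open>Continuity and uniform control of iterates\<close>

lemma tds_continuous_funpow:
  assumes "tds X T"
  shows "continuous_on X (T ^^ n) \<and> (T ^^ n) ` X \<subseteq> X"
proof (induction n)
  case (Suc n)
  have "continuous_on ((T ^^ n) ` X) T"
    using Suc assms continuous_on_subset unfolding tds_def by blast
  then have "continuous_on X (T \<circ> (T ^^ n))"
    using Suc continuous_on_compose by blast
  moreover have "T ` X \<subseteq> X"
    using assms unfolding tds_def by blast
  ultimately show ?case
    using Suc by auto
qed auto

lemma tds_funpow_in: "tds X T \<Longrightarrow> x \<in> X \<Longrightarrow> (T ^^ n) x \<in> X"
  using tds_continuous_funpow by blast

text \<open>Each iterate is uniformly continuous on the compact \<open>X\<close>; the smallest of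
  finitely many moduli controls a whole block of times.\<close>

lemma tds_uniform_funpow:
  assumes "tds X T" "e > 0"
  shows "\<exists>d>0. \<forall>x\<in>X. \<forall>y\<in>X. dist x y < d \<longrightarrow> (\<forall>i\<le>k. dist ((T ^^ i) x) ((T ^^ i) y) < e)"
proof (induction k)
  case 0
  then show ?case using assms by auto
next
  case (Suc k)
  then obtain d where d: "d > 0" "\<And>x y i. x \<in> X \<Longrightarrow> y \<in> X \<Longrightarrow> dist x y < d \<Longrightarrow> i \<le> k \<Longrightarrow> dist ((T ^^ i) x) ((T ^^ i) y) < e"
    by blast
  have "uniformly_continuous_on X (T ^^ Suc k)"
    using assms tds_continuous_funpow compact_uniformly_continuous unfolding tds_def by metis
  then obtain d' where d': "d' > 0" "\<And>x y. x \<in> X \<Longrightarrow> y \<in> X \<Longrightarrow> dist x y < d' \<Longrightarrow> dist ((T ^^ Suc k) x) ((T ^^ Suc k) y) < e"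
    using assms(2) unfolding uniformly_continuous_on_def by metis
  show ?case
    using d d' by (intro exI[of _ "min d d'"]) (auto simp: le_Suc_eq simp del: funpow.simps)
qed

section \<open>Proximal pairs: thick closeness and invariance\<close>

lemma proximal_iff:
  "proximal X T x y \<longleftrightarrow> x \<in> X \<and> y \<in> X \<and> (\<forall>e>0. \<exists>n. dist ((T ^^ n) x) ((T ^^ n) y) < e)"
proof -
  let ?f = "\<lambda>n. dist ((T ^^ n) x) ((T ^^ n) y)"
  have bdd: "bdd_below (range ?f)"
    by (meson bdd_belowI2 zero_le_dist)
  have "0 \<le> (INF n. ?f n)"
    by (rule cINF_greatest) auto
  then have "(INF n. ?f n) = 0 \<longleftrightarrow> \<not> 0 < (INF n. ?f n)"
    by linarith
  also have "\<dots> \<longleftrightarrow> (\<forall>e>0. (INF n. ?f n) < e)"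
    by (meson less_irrefl not_less order_less_le_trans)
  also have "\<dots> \<longleftrightarrow> (\<forall>e>0. \<exists>n. ?f n < e)"
    using cINF_less_iff[OF _ bdd] by auto
  finally show ?thesis
    unfolding proximal_def by blast
qed

text \<open>If the orbits come close enough at one time \<open>m\<close>, uniform continuity of the
  first \<open>k\<close> iterates keeps them \<open>e\<close>-close over the block that
  follows.\<close>

lemma proximal_thick:
  assumes "tds X T" "proximal X T x y" "e > 0"
  shows "thick {n. dist ((T ^^ n) x) ((T ^^ n) y) < e}"
  unfolding thick_def
proof
  fix k
  obtain d where d: "d > 0" "\<And>u v i. u \<in> X \<Longrightarrow> v \<in> X \<Longrightarrow> dist u v < d \<Longrightarrow> i \<le> k \<Longrightarrow> dist ((T ^^ i) u) ((T ^^ i) v) < e"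
    using tds_uniform_funpow[OF assms(1,3)] by metis
  have xy: "x \<in> X" "y \<in> X"
    using assms(2) by (auto simp: proximal_iff)
  obtain m where m: "dist ((T ^^ m) x) ((T ^^ m) y) < d"
    using assms(2) d(1) by (auto simp: proximal_iff)
  have "dist ((T ^^ n) x) ((T ^^ n) y) < e" if "n \<in> {m..<m+k}" for n
  proof -
    have "n = (n - m) + m" "n - m \<le> k"
      using that by auto
    then show ?thesis
      using d(2)[of "(T ^^ m) x" "(T ^^ m) y" "n - m"] m xy tds_funpow_in[OF assms(1)]
      by (metis comp_apply funpow_add)
  qed
  then show "\<exists>m. {m..<m+k} \<subseteq> {n. dist ((T ^^ n) x) ((T ^^ n) y) < e}"
    by blast
qed

text \<open>Closeness at time 0 says nothing about the images, so a close time that is a successor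
  is needed; a block of length 2 contains one.\<close>

lemma proximal_step:
  assumes "tds X T" "proximal X T x y"
  shows "proximal X T (T x) (T y)"
proof -
  have "\<exists>n. dist ((T ^^ n) (T x)) ((T ^^ n) (T y)) < e" if e: "e > 0" for e
  proof -
    obtain m where "{m..<m+2} \<subseteq> {n. dist ((T ^^ n) x) ((T ^^ n) y) < e}"
      using proximal_thick[OF assms e] unfolding thick_def by blast
    moreover have "Suc m \<in> {m..<m+2}"
      by simp
    ultimately have "dist ((T ^^ Suc m) x) ((T ^^ Suc m) y) < e"
      by blast
    then show ?thesis
      by (metis comp_apply funpow_Suc_right)
  qed
  then show ?thesis
    using assms tds_funpow_in[OF assms(1), of _ 1] by (auto simp: proximal_iff)
qed

lemma thick_shift:
  assumes "thick A"
  shows "thick {n. n + j \<in> A}"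
  unfolding thick_def
proof
  fix k
  obtain m where "{m..<m+(k+j)} \<subseteq> A"
    using assms unfolding thick_def by blast
  then have "{m..<m+k} \<subseteq> {n. n + j \<in> A}"
    by auto
  then show "\<exists>m. {m..<m+k} \<subseteq> {n. n + j \<in> A}" ..
qed

text \<open>The product map preserves the proximal relation and is continuous on the closed set
  \<open>X \<times> X\<close>, which contains the closure, so invariance passes to the
  limit.\<close>

lemma closure_proximal_rel_step:
  assumes "tds X T" "(x, y) \<in> closure (proximal_rel X T)"
  shows "(T x, T y) \<in> closure (proximal_rel X T)"
proof -
  let ?P = "proximal_rel X T"
  have "closed (X \<times> X)"
    using assms(1) unfolding tds_def by (simp add: closed_Times compact_imp_closed)
  then have sub: "closure ?P \<subseteq> X \<times> X"
    by (intro closure_minimal) (auto simp: proximal_rel_def proximal_def)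
  have "continuous_on (X \<times> X) (map_prod T T)"
  proof -
    have T: "continuous_on X T"
      using assms(1) unfolding tds_def by blast
    show ?thesis
      unfolding map_prod_def case_prod_beta
      by (intro continuous_on_Pair continuous_on_compose2[OF T] continuous_on_fst continuous_on_snd
          continuous_on_id) auto
  qed
  then have "map_prod T T ` closure ?P \<subseteq> closure ?P"
    using sub closure_subset[of ?P] proximal_step[OF assms(1)]
    by (intro image_closure_subset)
      (auto simp: proximal_rel_def intro: continuous_on_subset)
  then show ?thesis
    using assms(2) by force
qed

lemma minimal_hits:
  assumes "minimal_tds X T" "x \<in> X" "u \<in> X" "r > 0"
  shows "\<exists>n. dist u ((T ^^ n) x) < r"
proof -
  have "u \<in> closure (orbit T x)"
    using assms unfolding minimal_tds_def by blast
  then show ?thesis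
    using assms(4) unfolding closure_approachable orbit_def by (force simp: dist_commute)
qed

section \<open>Sensitivity from a non-closed proximal relation\<close>

lemma minimal_proximal_not_closed_imp_sensitive:
  assumes min: "minimal_tds X T" and ncl: "\<not> closed (proximal_rel X T)"
  shows "strongly_Ft_sensitive X T"
proof -
  let ?P = "proximal_rel X T"
  have tds: "tds X T"
    using min unfolding minimal_tds_def by blast
  have cX: "compact X" "closed X"
    using tds unfolding tds_def by (auto simp: compact_imp_closed)
  have sub: "closure ?P \<subseteq> X \<times> X"
    using cX by (intro closure_minimal closed_Times) (auto simp: proximal_rel_def proximal_def)
  have cP: "compact (closure ?P)"
    using compact_Int_closed[OF compact_Times[OF cX(1) cX(1)] closed_closure, of ?P] sub
    by (simp add: Int_absorb1)
  obtain x0 y0 where xy0: "(x0, y0) \<in> closure ?P" "(x0, y0) \<notin> ?P"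
    using ncl by (metis closure_subset_eq subsetI surj_pair)
  then have "x0 \<in> X" "y0 \<in> X" "\<not> proximal X T x0 y0"
    using sub by (auto simp: proximal_rel_def)
  then obtain d where d: "d > 0" "\<And>n. d \<le> dist ((T ^^ n) x0) ((T ^^ n) y0)"
    unfolding proximal_iff by (meson not_less)
  \<comment> \<open>The bound is non-strict, which makes \<open>M\<close> closed, and ranges over
    all times, which makes it survive passing to the images.\<close>
  define M where "M = {z \<in> closure ?P. \<forall>n. d \<le> dist ((T ^^ n) (fst z)) ((T ^^ n) (snd z))}"
  have contP: "continuous_on (closure ?P) (\<lambda>z. (T ^^ n) (fst z))"
    "continuous_on (closure ?P) (\<lambda>z. (T ^^ n) (snd z))" for n
  proof -
    have T: "continuous_on X (T ^^ n)"
      using tds_continuous_funpow[OF tds] by blast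
    show "continuous_on (closure ?P) (\<lambda>z. (T ^^ n) (fst z))"
      "continuous_on (closure ?P) (\<lambda>z. (T ^^ n) (snd z))"
      using sub by (intro continuous_on_compose2[OF T] continuous_on_fst continuous_on_snd
          continuous_on_id; force)+
  qed
  have "closed {z \<in> closure ?P. d \<le> dist ((T ^^ n) (fst z)) ((T ^^ n) (snd z))}" for n
    by (intro continuous_on_closed_Collect_le continuous_intros contP) simp
  moreover have "M = closure ?P \<inter> (\<Inter>n. {z \<in> closure ?P. d \<le> dist ((T ^^ n) (fst z)) ((T ^^ n) (snd z))})"
    unfolding M_def by auto
  ultimately have cM: "compact M"
    using cP by (simp add: closed_INT compact_Int_closed)
  have orbM: "((T ^^ n) x0, (T ^^ n) y0) \<in> M" for n
  proof -
    have "((T ^^ n) x0, (T ^^ n) y0) \<in> closure ?P"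
      by (induction n) (auto simp: xy0 closure_proximal_rel_step[OF tds])
    moreover have "d \<le> dist ((T ^^ k) ((T ^^ n) x0)) ((T ^^ k) ((T ^^ n) y0))" for k
      using d(2)[of "k + n"] by (simp add: funpow_add)
    ultimately show ?thesis
      unfolding M_def by simp
  qed
  \<comment> \<open>The projection is compact and contains the orbit of \<open>x0\<close>, which is
    dense by minimality.\<close>
  have fstM: "X \<subseteq> fst ` M"
  proof -
    have "closed (fst ` M)"
      using cM by (intro compact_imp_closed compact_continuous_image continuous_intros)
    moreover have "orbit T x0 \<subseteq> fst ` M"
      using orbM unfolding orbit_def by force
    ultimately have "closure (orbit T x0) \<subseteq> fst ` M"
      by (rule closure_minimal[rotated])
    then show ?thesis
      using min sub xy0(1) unfolding minimal_tds_def by blast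
  qed
  have "\<exists>x\<in>U. \<exists>y\<in>U. thick {n. dist ((T ^^ n) x) ((T ^^ n) y) > d/2}"
    if U: "openin (top_of_set X) U" "U \<noteq> {}" for U
  proof -
    obtain u where u: "u \<in> U" "u \<in> X"
      using U openin_imp_subset by fastforce
    obtain r' where r': "r' > 0" "ball u r' \<inter> X \<subseteq> U"
      using U(1) u(1) openin_contains_ball by metis
    \<comment> \<open>Two radii: the closed condition with \<open>r\<close> makes the sets
      \<open>C j\<close> compact, and the gap up to \<open>r'\<close> leaves room to perturb a
      point.\<close>
    define r where "r = r'/2"
    have r: "r > 0" "\<And>v. v \<in> X \<Longrightarrow> dist u v \<le> r \<Longrightarrow> v \<in> U" "r < r'"
      using r' unfolding r_def by auto
    define C where "C j = fst ` (M \<inter> {z \<in> closure ?P. dist u ((T ^^ j) (snd z)) \<le> r})" for j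
    have "closed {z \<in> closure ?P. dist u ((T ^^ j) (snd z)) \<le> r}" for j
      by (intro continuous_on_closed_Collect_le continuous_intros contP) simp
    then have "compact (C j)" for j
      unfolding C_def using cM
      by (intro compact_continuous_image continuous_intros compact_Int_closed)
    then have clC: "closedin (top_of_set X) (C j)" for j
      using sub by (intro closed_subset compact_imp_closed) (auto simp: C_def M_def)
    have "X \<subseteq> (\<Union>j. C j)"
    proof
      fix x assume "x \<in> X"
      then obtain y where y: "(x, y) \<in> M"
        using fstM by force
      then have "y \<in> X"
        using sub unfolding M_def by auto
      then obtain j where "dist u ((T ^^ j) y) < r"
        using minimal_hits[OF min _ u(2) r(1)] by blast
      then have "x \<in> C j"
        unfolding C_def using y by (force simp: M_def)
      then show "x \<in> (\<Union>j. C j)" by blast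
    qed
    then have XC: "(\<Union>j. C j) = X"
      using clC closedin_subset by fastforce
    \<comment> \<open>Otherwise Baire's theorem in the compact space \<open>X\<close> would give the
      union of the closed sets \<open>C j\<close>, which is all of \<open>X\<close>, empty interior,
      although \<open>u\<close> lies in \<open>X\<close>.\<close>
    obtain j where j: "top_of_set X interior_of C j \<noteq> {}"
    proof (rule ccontr)
      assume "\<not> thesis"
      then have "\<And>j. top_of_set X interior_of C j = {}"
        using that by blast
      moreover have "locally_compact_space (top_of_set X) \<and> regular_space (top_of_set X)"
        using cX(1) by (simp add: compact_imp_locally_compact_space compact_space_subtopology
            regular_space_subtopology regular_space_euclidean)
      ultimately have "top_of_set X interior_of \<Union>(range C) = {}"
        using clC by (intro Baire_category_alt) auto
      then show False
        using XC u(2) by (metis empty_iff interior_of_topspace topspace_euclidean_subtopology)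
    qed
    define V where "V = top_of_set X interior_of C j"
    obtain a where a: "a \<in> V" using j V_def by blast
    have V: "openin (top_of_set X) V" "V \<subseteq> C j"
      by (auto simp: V_def interior_of_subset)
    then obtain b where b: "(a, b) \<in> closure ?P" "dist u ((T ^^ j) b) \<le> r"
      using a unfolding C_def by force
    obtain W where W: "open W" "V = X \<inter> W"
      using V(1) openin_open by metis
    \<comment> \<open>The open ball of the larger radius gives \<open>b\<close> a neighbourhood
      whose points in \<open>X\<close> all enter \<open>U\<close> at time \<open>j\<close>.\<close>
    have "openin (top_of_set X) (X \<inter> (T ^^ j) -` ball u r')"
      using tds_continuous_funpow[OF tds] by (intro continuous_openin_preimage_gen) auto
    then obtain W' where W': "open W'" "X \<inter> (T ^^ j) -` ball u r' = X \<inter> W'"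
      using openin_open by metis
    have bX: "b \<in> X" using b(1) sub by auto
    then have "b \<in> X \<inter> W'"
      using b(2) r(3) W'(2) by auto
    then have "(a, b) \<in> W \<times> W'" "open (W \<times> W')"
      using a W W'(1) by (auto intro: open_Times)
    then have "?P \<inter> (W \<times> W') \<noteq> {}"
      using b(1) open_Int_closure_eq_empty by (metis Int_iff emptyE inf_commute)
    then obtain x y where xy: "proximal X T x y" "x \<in> W" "y \<in> W'"
      unfolding proximal_rel_def by auto
    have xyX: "x \<in> X" "y \<in> X"
      using xy(1) by (auto simp: proximal_iff)
    have "y \<in> X \<inter> (T ^^ j) -` ball u r'"
      using W'(2) xyX(2) xy(3) by blast
    then have yU: "(T ^^ j) y \<in> U"
      using r'(2) xyX tds_funpow_in[OF tds] by auto
    \<comment> \<open>This is where interior is used: the approximating point \<open>x\<close>, and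
      not only \<open>a\<close>, has a partner in \<open>M\<close> that enters \<open>U\<close> at
      time \<open>j\<close>.\<close>
    have "x \<in> C j" using W(2) V(2) xy(2) xyX(1) by blast
    then obtain x' where x': "(x, x') \<in> M" "dist u ((T ^^ j) x') \<le> r"
      unfolding C_def by force
    then have "x' \<in> X" using sub unfolding M_def by auto
    then have xU: "(T ^^ j) x' \<in> U"
      using r(2) x'(2) tds_funpow_in[OF tds] by auto
    \<comment> \<open>The pair found in \<open>U\<close> is already advanced by \<open>j\<close>, so
      closeness of \<open>x\<close> and \<open>y\<close> is needed at times
      \<open>n + j\<close>.\<close>
    have "thick {n. n + j \<in> {n. dist ((T ^^ n) x) ((T ^^ n) y) < d/2}}"
      using thick_shift proximal_thick[OF tds xy(1)] d(1) by (meson half_gt_zero)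
    moreover have "dist ((T ^^ n) ((T ^^ j) x')) ((T ^^ n) ((T ^^ j) y)) > d/2"
      if "dist ((T ^^ (n + j)) x) ((T ^^ (n + j)) y) < d/2" for n
    proof -
      have "d \<le> dist ((T ^^ (n + j)) x) ((T ^^ (n + j)) x')"
        using x'(1) unfolding M_def by auto
      also have "\<dots> \<le> dist ((T ^^ (n + j)) x) ((T ^^ (n + j)) y) + dist ((T ^^ (n + j)) x') ((T ^^ (n + j)) y)"
        by (rule dist_triangle2)
      finally show ?thesis
        using that by (simp add: funpow_add)
    qed
    ultimately have "thick {n. dist ((T ^^ n) ((T ^^ j) x')) ((T ^^ n) ((T ^^ j) y)) > d/2}"
      unfolding thick_def by (metis (mono_tags, lifting) mem_Collect_eq subset_iff)
    then show ?thesis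
      using xU yU by blast
  qed
  then show ?thesis
    unfolding strongly_Ft_sensitive_def using d(1) by (intro exI[of _ "d/2"]) auto
qed

theorem theorem5p8:
  fixes X1 :: "'a::metric_space set" and T1 :: "'a \<Rightarrow> 'a"
    and X2 :: "'b::metric_space set" and T2 :: "'b \<Rightarrow> 'b"
    and X3 :: "'c::metric_space set" and T3 :: "'c \<Rightarrow> 'c"
    and \<pi>1 :: "'b \<Rightarrow> 'a" and \<pi>2 :: "'c \<Rightarrow> 'b"
  assumes "minimal_tds X3 T3"
    and "\<exists>g. homeomorphism X3 X3 T3 g"
    and "proximal_extension X2 T2 X1 T1 \<pi>1" and "\<not> conjugacy X2 T2 X1 T1 \<pi>1"
    and "distal_extension X3 T3 X2 T2 \<pi>2" and "\<not> conjugacy X3 T3 X2 T2 \<pi>2"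
    and "distal_tds X1 T1"
    and "\<not> closed (proximal_rel X3 T3)"
  shows "strongly_Ft_sensitive X3 T3"
  using assms(1,8) by (rule minimal_proximal_not_closed_imp_sensitive)

end
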